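(* A graph $G$ of order $n$ is a universal fixer if and only if $G = \overline{K_n}$.
   Context: All graphs are finite, simple and undirected. The order of $G$ is $|V(G)|$, and $\overline{K_n}$ denotes the graph consisting of $n$ isolated vertices (equality of graphs is up to isomorphism). A set $D \subseteq V(G)$ dominates $G$ if every vertex of $G$ is in $D$ or adjacent to a vertex of $D$; the domination number $\gamma(G)$ is the minimum cardinality of a dominating set of $G$. Given a graph $G$ and a permutation $\pi$ of $V(G)$ (any bijection $V(G)\to V(G)$, not necessarily an automorphism), the graph $\pi G$ is obtained by taking two disjoint copies $G^1$ and $G^2$ of $G$ and joining every $u \in V(G^1)$ by an edge to $\pi(u) \in V(G^2)$. $G$ is a universal fixer if $\gamma(\pi G) = \gamma(G)$ for every permutation $\pi$ of $V(G)$. *)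

theory Defs
  imports "Graph_Theory.Graph_Theory" "HOL-Combinatorics.Permutations"
begin

text \<open>
  A finite simple undirected graph is a \<^locale>\<open>pair_graph\<close>: a finite vertex set together with an
  irreflexive, symmetric arc relation on it, so that an edge \<open>uv\<close> is the pair of arcs \<open>(u, v)\<close>
  and \<open>(v, u)\<close>. The null graph is allowed. Equality of graphs up to isomorphism
  is \<^const>\<open>digraph_iso\<close>.
\<close>

definition edgeless_graph :: "nat \<Rightarrow> nat pair_pre_digraph" where
  "edgeless_graph n = \<lparr> pverts = {..<n}, parcs = {} \<rparr>"

definition dominating_set :: "'a pair_pre_digraph \<Rightarrow> 'a set \<Rightarrow> bool" where
  "dominating_set G D \<longleftrightarrow>
    D \<subseteq> pverts G \<and> (\<forall>v\<in>pverts G. v \<in> D \<or> (\<exists>u\<in>D. (u, v) \<in> parcs G))"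

definition domination_number :: "'a pair_pre_digraph \<Rightarrow> nat" where
  "domination_number G = Min {card D | D. dominating_set G D}"

text \<open>
  In \<open>\<pi>G\<close> the copies \<open>G\<^sup>1\<close> and \<open>G\<^sup>2\<close> of \<open>G\<close> live on the vertices \<^term>\<open>Inl u\<close>
  and \<^term>\<open>Inr u\<close>, respectively.
\<close>

definition permutation_graph ::
    "('a \<Rightarrow> 'a) \<Rightarrow> 'a pair_pre_digraph \<Rightarrow> ('a + 'a) pair_pre_digraph" where
  "permutation_graph \<pi> G =
    \<lparr> pverts = pverts G <+> pverts G,
      parcs = {(Inl u, Inl v) | u v. (u, v) \<in> parcs G}
            \<union> {(Inr u, Inr v) | u v. (u, v) \<in> parcs G}
            \<union> {(Inl u, Inr (\<pi> u)) | u. u \<in> pverts G}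
            \<union> {(Inr (\<pi> u), Inl u) | u. u \<in> pverts G} \<rparr>"

definition universal_fixer :: "'a pair_pre_digraph \<Rightarrow> bool" where
  "universal_fixer G \<longleftrightarrow>
    (\<forall>\<pi>. \<pi> permutes pverts G \<longrightarrow> domination_number (permutation_graph \<pi> G) = domination_number G)"

lemma pair_graph_edgeless_graph: "pair_graph (edgeless_graph n)"
  by unfold_locales (auto simp: edgeless_graph_def symmetric_def sym_def)

lemma pair_graph_permutation_graph:
  assumes "pair_graph G" and "\<pi> permutes pverts G"
  shows "pair_graph (permutation_graph \<pi> G)"
proof -
  interpret pair_graph G by fact
  have \<pi>: "\<pi> u \<in> pverts G" if "u \<in> pverts G" for u
    using that assms(2) by (simp add: permutes_in_image)
  have sub: "parcs (permutation_graph \<pi> G)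
      \<subseteq> pverts (permutation_graph \<pi> G) \<times> pverts (permutation_graph \<pi> G)"
    using \<pi> by (auto simp: permutation_graph_def dest: in_arcsD1 in_arcsD2)
  have fin: "finite (pverts (permutation_graph \<pi> G))"
    by (simp add: permutation_graph_def)
  show ?thesis
  proof unfold_locales
    show "finite (parcs (permutation_graph \<pi> G))"
      using finite_subset[OF sub] fin by simp
    show "symmetric (with_proj (permutation_graph \<pi> G))"
      by (auto simp: symmetric_def sym_def permutation_graph_def dest: arcs_symmetric)
    show "fst e \<noteq> snd e" if "e \<in> parcs (permutation_graph \<pi> G)" for e
      using that no_loops' by (auto simp: permutation_graph_def)
  qed (use sub fin in auto)
qed

end

theory Submission
  imports Defs
begin

text \<open>
  If \<open>G\<close> has no edges, \<open>\<pi>G\<close> is a perfect matching with one edge for each vertex of \<open>G\<close>, so both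
  domination numbers equal the order of \<open>G\<close>. The content is the converse: from an edge one has to
  produce a permutation that raises the domination number.

  Suppose \<open>\<gamma>(\<pi>G) = \<gamma>(G)\<close>. A minimum dominating set of \<open>\<pi>G\<close> consists of a set \<open>X\<close> in the first copy
  and a set \<open>\<pi>(Y)\<close> in the second one. The vertices of the first copy that \<open>X\<close> does not dominate
  must lie in \<open>Y\<close>, and minimality of \<open>\<gamma>(G)\<close> forces \<open>Y = V - N[X]\<close>; in the same way
  \<open>\<pi>(X) = V - N[\<pi>(Y)]\<close> (\<open>fixed_domination_number_splits\<close>). Exchanging two elements of \<open>Y\<close> for one
  vertex dominating both would beat \<open>\<gamma>(G)\<close>, so a closed neighbourhood \<open>N[v]\<close> contains at most one
  element of \<open>Y\<close>, and at most one of \<open>\<pi>(X)\<close> (\<open>complementary_pair_packing\<close>).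

  Now take a vertex \<open>p\<close> with a neighbour, and let \<open>\<pi>\<close> permute \<open>N[p]\<close> cyclically and fix everything
  else. Every dominating set meets \<open>N[p]\<close>, so \<open>X\<close> and \<open>Y\<close> cannot both avoid it, while they have at
  most one element each there. If only one of them meets \<open>N[p]\<close>, there is a contradiction at once. The
  remaining case is \<open>x \<in> X\<close>, \<open>y \<in> Y\<close> with \<open>x, y, \<pi>(x), \<pi>(y)\<close> all in the open neighbourhood \<open>N(p)\<close>.
  Since outside \<open>N[p]\<close> the two decompositions agree, the neighbourhoods of \<open>y\<close> and \<open>\<pi>(y)\<close> are
  tightly related: \<open>N[y] - {\<pi>(x)} \<subseteq> N[\<pi>(y)]\<close>, while \<open>x\<close> is adjacent to \<open>\<pi>(y)\<close> but not to \<open>y\<close>.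

  The cyclic order is chosen to exclude this. Number \<open>N(p)\<close> by \<open>1, \<dots>, d\<close> through a bijection \<open>\<phi>\<close>, put
  \<open>\<phi> = 0\<close> elsewhere, and choose \<open>\<phi>\<close> so that the sum of \<open>\<phi>(u) \<phi>(v)\<close> over all arcs \<open>uv\<close> is as large
  as possible; let \<open>\<pi>\<close> lower \<open>\<phi>\<close> by one on \<open>N(p)\<close> and send \<open>p\<close> to the top. Passing from \<open>y\<close> to
  \<open>\<pi>(y)\<close>, the neighbourhood gains \<open>x\<close> and loses at most \<open>\<pi>(x)\<close>, which has the smaller number. Hence
  exchanging the consecutive numbers of \<open>y\<close> and \<open>\<pi>(y)\<close> would increase the sum, contradicting the
  choice of \<open>\<phi>\<close>.
\<close>

section \<open>Domination numbers\<close>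

definition closed_nbhd :: "'a pair_pre_digraph \<Rightarrow> 'a set \<Rightarrow> 'a set" where
  "closed_nbhd G X = X \<union> parcs G `` X"

lemma dominating_set_iff:
  "dominating_set G D \<longleftrightarrow> D \<subseteq> pverts G \<and> pverts G \<subseteq> closed_nbhd G D"
  by (auto simp: dominating_set_def closed_nbhd_def)

lemma finite_dominating_cards:
  assumes "finite (pverts G)"
  shows "finite {card D | D. dominating_set G D}"
proof (rule finite_subset)
  show "{card D | D. dominating_set G D} \<subseteq> {..card (pverts G)}"
    using assms by (auto simp: dominating_set_def intro: card_mono)
qed simp

lemma domination_number_le:
  assumes "finite (pverts G)" "dominating_set G D"
  shows "domination_number G \<le> card D"
  unfolding domination_number_def
  using assms by (intro Min_le finite_dominating_cards) auto

lemma domination_number_attained: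
  assumes "finite (pverts G)"
  obtains D where "dominating_set G D" "card D = domination_number G"
proof -
  have "dominating_set G (pverts G)"
    by (simp add: dominating_set_def)
  then have "domination_number G \<in> {card D | D. dominating_set G D}"
    unfolding domination_number_def
    using assms by (intro Min_in finite_dominating_cards) auto
  then show thesis
    using that by auto
qed

section \<open>Minimum dominating sets of a permutation graph\<close>

text \<open>
  If \<open>Y\<close> is the set of vertices that \<open>X\<close> leaves undominated, then \<open>X \<union> Y\<close> is a dominating set. The
  condition on the cardinalities makes it a minimum one.
\<close>

definition complementary_pair :: "'a pair_pre_digraph \<Rightarrow> 'a set \<Rightarrow> 'a set \<Rightarrow> bool" where
  "complementary_pair G X Y \<longleftrightarrow>
    X \<subseteq> pverts G \<and> Y = pverts G - closed_nbhd G X \<and> card X + card Y = domination_number G"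

text \<open>
  Adding to \<open>X\<close> just the vertices it misses already gives a dominating set, so the cardinality
  condition leaves no room for \<open>Y\<close> to contain anything more.
\<close>

lemma (in pair_graph) complementary_pairI:
  assumes "X \<subseteq> pverts G" "Y \<subseteq> pverts G" "pverts G - closed_nbhd G X \<subseteq> Y"
    and card: "card X + card Y = domination_number G"
  shows "complementary_pair G X Y"
proof -
  let ?R = "pverts G - closed_nbhd G X"
  have fin: "finite X" "finite Y" "finite ?R"
    using assms(1,2) by (auto intro: finite_subset[OF _ pair_finite_verts])
  have "dominating_set G (X \<union> ?R)"
    using assms(1) by (auto simp: dominating_set_iff closed_nbhd_def)
  then have "domination_number G \<le> card (X \<union> ?R)"
    by (intro domination_number_le) auto
  also have "\<dots> \<le> card X + card ?R"
    by (rule card_Un_le)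
  finally have "card Y \<le> card ?R"
    using card by simp
  then have "?R = Y"
    using fin assms(3) by (simp add: card_seteq)
  then show ?thesis
    using assms(1) card by (simp add: complementary_pair_def)
qed

text \<open>
  If a closed neighbourhood \<open>N[v]\<close> contained two elements of \<open>Y\<close>, replacing both by \<open>v\<close> would give a
  dominating set that is too small. Taking \<open>v \<in> Y\<close> shows that \<open>Y\<close> is independent.
\<close>

lemma (in pair_graph) complementary_pair_packing:
  assumes XY: "complementary_pair G X Y" and v: "v \<in> pverts G"
    and y: "y \<in> Y" "y \<in> closed_nbhd G {v}" and z: "z \<in> Y" "z \<in> closed_nbhd G {v}"
  shows "y = z"
proof (rule ccontr)
  assume "y \<noteq> z"
  let ?D = "insert v X \<union> (Y - {y, z})"
  have X: "X \<subseteq> pverts G" and Y: "Y = pverts G - closed_nbhd G X"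
    and card: "card X + card Y = domination_number G"
    using XY by (auto simp: complementary_pair_def)
  have fin: "finite X" "finite Y"
    using X Y by (auto intro: finite_subset[OF _ pair_finite_verts])
  have "dominating_set G ?D"
    using X Y v y z by (auto simp: dominating_set_iff closed_nbhd_def)
  then have "domination_number G \<le> card ?D"
    by (intro domination_number_le) auto
  also have "\<dots> \<le> card (insert v X) + card (Y - {y, z})"
    by (rule card_Un_le)
  also have "card (insert v X) \<le> Suc (card X)"
    using fin by (simp add: card_insert_if)
  also have "card (Y - {y, z}) = card Y - 2"
    using y z \<open>y \<noteq> z\<close> fin by (simp add: card_Diff_subset)
  finally have "domination_number G \<le> Suc (card X) + (card Y - 2)" by simp
  moreover have "card {y, z} \<le> card Y"
    using y z fin by (intro card_mono) auto
  ultimately show False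
    using card \<open>y \<noteq> z\<close> by simp
qed

text \<open>
  Here \<open>X\<close> is the part of a minimum dominating set in the first copy and \<open>Y\<close> consists of the
  partners of its part in the second copy. A vertex of one copy has a single neighbour in the other,
  so what one part misses in its own copy is matched into the other part. The roles of the two sets
  are exchanged in the second copy.
\<close>

lemma (in pair_graph) fixed_domination_number_splits:
  assumes \<pi>: "\<pi> permutes pverts G"
    and fixed: "domination_number (permutation_graph \<pi> G) = domination_number G"
  obtains X Y where "complementary_pair G X Y" "complementary_pair G (\<pi> ` Y) (\<pi> ` X)"
proof -
  let ?V = "pverts G"
  have "finite (pverts (permutation_graph \<pi> G))"
    by (simp add: permutation_graph_def)
  then obtain D where D: "dominating_set (permutation_graph \<pi> G) D"
    and cardD: "card D = domination_number G"
    using domination_number_attained fixed by metis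
  define X Y where "X = {u \<in> ?V. Inl u \<in> D}" and "Y = {u \<in> ?V. Inr (\<pi> u) \<in> D}"
  have inj: "inj \<pi>"
    using \<pi> by (rule permutes_inj)
  have im: "\<pi> ` ?V = ?V"
    using \<pi> by (rule permutes_image)
  have sub: "X \<subseteq> ?V" "Y \<subseteq> ?V" "\<pi> ` X \<subseteq> ?V" "\<pi> ` Y \<subseteq> ?V"
    using im by (auto simp: X_def Y_def)
  have "D \<subseteq> ?V <+> ?V"
    using D by (simp add: dominating_set_def permutation_graph_def)
  then have "D = X <+> \<pi> ` Y"
    using im by (force simp: X_def Y_def)
  moreover have "finite X" "finite Y"
    using sub by (auto intro: finite_subset[OF _ pair_finite_verts])
  ultimately have "card X + card (\<pi> ` Y) = domination_number G"
    using cardD by (simp add: card_Plus)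
  moreover have "card (\<pi> ` Y) = card Y" "card (\<pi> ` X) = card X"
    using inj by (auto intro: card_image inj_on_subset)
  ultimately have card: "card X + card Y = domination_number G"
      "card (\<pi> ` Y) + card (\<pi> ` X) = domination_number G"
    by auto
  have "u \<in> Y" if "u \<in> ?V" "u \<notin> closed_nbhd G X" for u
  proof -
    have "Inl u \<in> D \<or> (\<exists>w\<in>D. (w, Inl u) \<in> parcs (permutation_graph \<pi> G))"
      using D that(1) by (auto simp: dominating_set_def permutation_graph_def)
    then show ?thesis
      using that in_arcsD1 injD[OF inj]
      by (auto simp: X_def Y_def closed_nbhd_def permutation_graph_def)
  qed
  then have "complementary_pair G X Y"
    using sub card by (intro complementary_pairI) auto
  moreover have "w \<in> \<pi> ` X" if "w \<in> ?V" "w \<notin> closed_nbhd G (\<pi> ` Y)" for w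
  proof -
    have Y: "\<pi> ` Y = {u \<in> ?V. Inr u \<in> D}"
      using im by (auto simp: Y_def)
    have "Inr w \<in> D \<or> (\<exists>u\<in>D. (u, Inr w) \<in> parcs (permutation_graph \<pi> G))"
      using D that(1) by (auto simp: dominating_set_def permutation_graph_def)
    then show ?thesis
      using that in_arcsD1 unfolding Y
      by (auto simp: X_def closed_nbhd_def permutation_graph_def)
  qed
  then have "complementary_pair G (\<pi> ` Y) (\<pi> ` X)"
    using sub card by (intro complementary_pairI) auto
  ultimately show thesis
    using that by blast
qed

section \<open>An extremal ordering of a neighbourhood\<close>

lemma quadratic_form_add:
  fixes f h :: "'a \<Rightarrow> 'b::comm_ring_1" and c :: "'a \<Rightarrow> 'a \<Rightarrow> 'b"
  assumes "\<And>u v. c u v = c v u"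
  shows "(\<Sum>u\<in>V. \<Sum>v\<in>V. c u v * (f u + h u) * (f v + h v)) =
    (\<Sum>u\<in>V. \<Sum>v\<in>V. c u v * f u * f v) + 2 * (\<Sum>u\<in>V. f u * (\<Sum>v\<in>V. c u v * h v))
    + (\<Sum>u\<in>V. h u * (\<Sum>v\<in>V. c u v * h v))"
proof -
  have "(\<Sum>u\<in>V. \<Sum>v\<in>V. c u v * h u * f v) = (\<Sum>v\<in>V. \<Sum>u\<in>V. c u v * h u * f v)"
    by (rule sum.swap)
  also have "\<dots> = (\<Sum>u\<in>V. \<Sum>v\<in>V. c u v * f u * h v)"
    using assms by (intro sum.cong refl) (simp add: mult_ac)
  finally show ?thesis
    by (simp add: algebra_simps sum.distrib sum_distrib_left)
qed

definition arc_weight :: "'a pair_pre_digraph \<Rightarrow> ('a \<Rightarrow> int) \<Rightarrow> int" where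
  "arc_weight G \<phi> = (\<Sum>u\<in>pverts G. \<Sum>v\<in>pverts G. of_bool ((u, v) \<in> parcs G) * \<phi> u * \<phi> v)"

text \<open>
  Exchanging two consecutive values adds the vector that is \<open>1\<close> at \<open>z\<close>, \<open>-1\<close> at \<open>y\<close> and \<open>0\<close>
  elsewhere to \<open>\<phi>\<close>. A possible edge between \<open>y\<close> and \<open>z\<close> keeps its contribution, which is why \<open>y\<close> and
  \<open>z\<close> are left out of each other's neighbourhood.
\<close>

lemma (in pair_graph) arc_weight_transpose:
  assumes y: "y \<in> pverts G" and z: "z \<in> pverts G" and \<phi>: "\<phi> y = \<phi> z + 1"
  shows "arc_weight G (\<phi> \<circ> transpose y z) = arc_weight G \<phi>
    + 2 * ((\<Sum>v\<in>parcs G `` {z} - {y}. \<phi> v) - (\<Sum>v\<in>parcs G `` {y} - {z}. \<phi> v))"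
proof -
  let ?V = "pverts G"
  define c :: "'a \<Rightarrow> 'a \<Rightarrow> int" where "c u v = of_bool ((u, v) \<in> parcs G)" for u v
  define h :: "'a \<Rightarrow> int" where "h v = of_bool (v = z) - of_bool (v = y)" for v
  have "y \<noteq> z" using \<phi> by auto
  have shift: "(\<phi> \<circ> transpose y z) v = \<phi> v + h v" for v
    using \<phi> by (auto simp: h_def transpose_def)
  have sym: "c u v = c v u" for u v
    using arcs_symmetric by (auto simp: c_def)
  have diag: "c v v = 0" for v
    using no_loops' by (auto simp: c_def)
  have ch: "(\<Sum>v\<in>?V. c u v * h v) = c z u - c y u" for u
  proof -
    have "(\<Sum>v\<in>?V. c u v * h v)
        = (\<Sum>v\<in>?V. if v = z then c u v else 0) - (\<Sum>v\<in>?V. if v = y then c u v else 0)"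
      unfolding sum_subtractf[symmetric] by (intro sum.cong) (auto simp: h_def)
    then show ?thesis using y z sym by simp
  qed
  have nbr: "(\<Sum>u\<in>?V. \<phi> u * c w u) = (\<Sum>u\<in>parcs G `` {w}. \<phi> u)" for w
  proof -
    have "(\<Sum>u\<in>?V. \<phi> u * c w u) = (\<Sum>u\<in>?V. if u \<in> parcs G `` {w} then \<phi> u else 0)"
      by (intro sum.cong) (auto simp: c_def)
    also have "\<dots> = (\<Sum>u\<in>?V \<inter> parcs G `` {w}. \<phi> u)"
      by (simp add: sum.inter_restrict)
    also have "?V \<inter> parcs G `` {w} = parcs G `` {w}"
      using in_arcsD2 by auto
    finally show ?thesis .
  qed
  have drop: "(\<Sum>u\<in>parcs G `` {w}. \<phi> u) = (\<Sum>u\<in>parcs G `` {w} - {x}. \<phi> u) + c w x * \<phi> x" for w x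
  proof -
    have "finite (parcs G `` {w})"
      by (rule finite_subset[of _ ?V]) (use in_arcsD2 in auto)
    then show ?thesis by (auto simp: c_def sum_diff1)
  qed
  have "arc_weight G (\<phi> \<circ> transpose y z)
      = (\<Sum>u\<in>?V. \<Sum>v\<in>?V. c u v * (\<phi> u + h u) * (\<phi> v + h v))"
    by (simp only: arc_weight_def shift c_def)
  also have "\<dots> = arc_weight G \<phi> + 2 * (\<Sum>u\<in>?V. \<phi> u * (c z u - c y u))
      + (\<Sum>u\<in>?V. h u * (c z u - c y u))"
    unfolding quadratic_form_add[of c, OF sym] ch by (simp add: arc_weight_def c_def)
  also have "(\<Sum>u\<in>?V. h u * (c z u - c y u)) = - 2 * c y z"
  proof -
    have "(\<Sum>u\<in>?V. h u * (c z u - c y u)) = (\<Sum>u\<in>?V. c z u * h u) - (\<Sum>u\<in>?V. c y u * h u)"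
      by (simp add: sum_subtractf algebra_simps)
    then show ?thesis using ch diag sym[of y z] by simp
  qed
  also have "(\<Sum>u\<in>?V. \<phi> u * (c z u - c y u))
      = (\<Sum>u\<in>parcs G `` {z}. \<phi> u) - (\<Sum>u\<in>parcs G `` {y}. \<phi> u)"
    by (simp add: right_diff_distrib sum_subtractf nbr)
  finally show ?thesis
    using drop[of z y] drop[of y z] sym[of y z] \<phi> by (simp add: algebra_simps comp_def)
qed

text \<open>
  A numbering of largest arc weight does the job: were the inequality to fail for \<open>y\<close> and \<open>z\<close>,
  exchanging their numbers would increase the weight.
\<close>

lemma (in pair_graph) extremal_numbering:
  assumes N: "N \<subseteq> pverts G"
  obtains \<phi> :: "'a \<Rightarrow> int" where "bij_betw \<phi> N {1..int (card N)}" "\<forall>v. v \<notin> N \<longrightarrow> \<phi> v = 0"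
    "\<forall>y\<in>N. \<forall>z\<in>N. \<phi> y = \<phi> z + 1 \<longrightarrow>
      (\<Sum>v\<in>parcs G `` {z} - {y}. \<phi> v) \<le> (\<Sum>v\<in>parcs G `` {y} - {z}. \<phi> v)"
proof -
  let ?V = "pverts G" and ?d = "int (card N)"
  let ?P = "\<lambda>\<phi>::'a \<Rightarrow> int. bij_betw \<phi> N {1..?d} \<and> (\<forall>v. v \<notin> N \<longrightarrow> \<phi> v = 0)"
  have finN: "finite N"
    using N by (auto intro: finite_subset[OF _ pair_finite_verts])
  then obtain g where g: "bij_betw g N {1..?d}"
    using finite_same_card_bij[of N "{1..?d}"] by auto
  have "bij_betw (\<lambda>v. if v \<in> N then g v else 0) N {1..?d}"
    using g by (subst bij_betw_cong[of _ _ g]) auto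
  then have ex: "?P (\<lambda>v. if v \<in> N then g v else 0)"
    by simp
  have bound: "0 \<le> arc_weight G \<phi> \<and> arc_weight G \<phi> \<le> (\<Sum>u\<in>?V. \<Sum>v\<in>?V. ?d * ?d)" if "?P \<phi>" for \<phi>
  proof -
    have *: "0 \<le> \<phi> v \<and> \<phi> v \<le> ?d" for v
      using that bij_betw_apply[of \<phi> N "{1..?d}" v] by (cases "v \<in> N") auto
    have lower: "0 \<le> of_bool b * \<phi> u * \<phi> v" for b u v
      using *[of u] *[of v] by simp
    have upper: "of_bool b * \<phi> u * \<phi> v \<le> ?d * ?d" for b u v
    proof -
      have "\<phi> u * \<phi> v \<le> ?d * ?d"
        by (rule mult_mono) (use * in auto)
      then show ?thesis by (cases b) simp_all
    qed
    show ?thesis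
      unfolding arc_weight_def
    proof
      show "0 \<le> (\<Sum>u\<in>?V. \<Sum>v\<in>?V. of_bool ((u, v) \<in> parcs G) * \<phi> u * \<phi> v)"
        by (rule sum_nonneg, rule sum_nonneg, rule lower)
      show "(\<Sum>u\<in>?V. \<Sum>v\<in>?V. of_bool ((u, v) \<in> parcs G) * \<phi> u * \<phi> v)
          \<le> (\<Sum>u\<in>?V. \<Sum>v\<in>?V. ?d * ?d)"
        by (rule sum_mono, rule sum_mono, rule upper)
    qed
  qed
  have "\<exists>\<phi>. ?P \<phi> \<and> (\<forall>\<psi>. ?P \<psi> \<longrightarrow> nat (arc_weight G \<psi>) \<le> nat (arc_weight G \<phi>))"
  proof (rule ex_has_greatest_nat[where f = "\<lambda>\<phi>. nat (arc_weight G \<phi>)" and P = ?P, OF ex])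
    show "\<forall>\<phi>. ?P \<phi> \<longrightarrow> nat (arc_weight G \<phi>) < Suc (nat (\<Sum>u\<in>?V. \<Sum>v\<in>?V. ?d * ?d))"
      using bound nat_mono by (simp only: less_Suc_eq_le) blast
  qed
  then obtain \<phi> where \<phi>: "?P \<phi>"
    and max: "\<And>\<psi>. ?P \<psi> \<Longrightarrow> nat (arc_weight G \<psi>) \<le> nat (arc_weight G \<phi>)"
    by blast
  have "(\<Sum>v\<in>parcs G `` {z} - {y}. \<phi> v) \<le> (\<Sum>v\<in>parcs G `` {y} - {z}. \<phi> v)"
    if yz: "y \<in> N" "z \<in> N" "\<phi> y = \<phi> z + 1" for y z
  proof -
    have P: "?P (\<phi> \<circ> transpose y z)"
    proof
      show "bij_betw (\<phi> \<circ> transpose y z) N {1..?d}"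
        by (rule bij_betw_trans[OF permutes_imp_bij[OF permutes_swap_id[OF yz(1,2)]] conjunct1[OF \<phi>]])
      show "\<forall>v. v \<notin> N \<longrightarrow> (\<phi> \<circ> transpose y z) v = 0"
        using \<phi> yz by (auto simp: transpose_def)
    qed
    have "arc_weight G (\<phi> \<circ> transpose y z) \<le> arc_weight G \<phi>"
      using max[OF P] bound[OF P] bound[OF \<phi>] by linarith
    moreover have "y \<in> ?V" "z \<in> ?V"
      using yz N by auto
    ultimately show ?thesis
      using arc_weight_transpose[of y z \<phi>] yz(3) by simp
  qed
  then show thesis
    using that[of \<phi>] \<phi> by simp
qed

lemma cyclic_descent_permutation:
  fixes \<phi> :: "'a \<Rightarrow> int"
  assumes \<phi>: "bij_betw \<phi> S {0..d}" and "0 < d"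
  obtains \<pi> where "\<pi> permutes S" "\<forall>v\<in>S. \<pi> v \<noteq> v"
    "\<forall>v\<in>S. 0 < \<phi> v \<longrightarrow> \<phi> (\<pi> v) = \<phi> v - 1"
proof -
  define \<rho> where "\<rho> k = (if k = 0 then d else k - 1)" for k
  define g where "g = inv_into S \<phi>"
  have g: "bij_betw g {0..d} S"
    unfolding g_def by (rule bij_betw_inv_into[OF \<phi>])
  have \<rho>: "bij_betw \<rho> {0..d} {0..d}"
    by (rule bij_betw_byWitness[where f' = "\<lambda>k. if k = d then 0 else k + 1"])
      (use \<open>0 < d\<close> in \<open>auto simp: \<rho>_def\<close>)
  define \<pi> where "\<pi> v = (if v \<in> S then g (\<rho> (\<phi> v)) else v)" for v
  have "bij_betw (g \<circ> (\<rho> \<circ> \<phi>)) S S"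
    by (rule bij_betw_trans[OF bij_betw_trans[OF \<phi> \<rho>] g])
  then have "bij_betw \<pi> S S"
    by (subst bij_betw_cong[of _ _ "g \<circ> (\<rho> \<circ> \<phi>)"]) (auto simp: \<pi>_def)
  then have "\<pi> permutes S"
    by (rule bij_imp_permutes) (simp add: \<pi>_def)
  moreover have \<phi>\<pi>: "\<phi> (\<pi> v) = \<rho> (\<phi> v)" if "v \<in> S" for v
  proof -
    have "\<rho> (\<phi> v) \<in> {0..d}"
      using that \<phi> \<rho> by (meson bij_betwE)
    then show ?thesis
      using that \<phi> by (simp add: \<pi>_def g_def bij_betw_inv_into_right)
  qed
  moreover have "\<pi> v \<noteq> v" if "v \<in> S" for v
    using \<phi>\<pi>[OF that] \<open>0 < d\<close> by (auto simp: \<rho>_def split: if_splits)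
  ultimately show thesis
    using that by (auto simp: \<rho>_def)
qed

section \<open>A permutation raising the domination number\<close>

text \<open>
  The closed neighbourhood \<open>S\<close> of \<open>p\<close> suits as the support of the permutation because every dominating
  set meets it, and because it contains at most one vertex of \<open>Y\<close> and at most one of \<open>\<pi> ` X\<close>. Being
  mapped onto itself, it then contains at most one vertex of \<open>X\<close> as well.
\<close>

lemma (in pair_graph) not_universal_fixer_if_arc:
  assumes "(p, q) \<in> parcs G"
  shows "\<not> universal_fixer G"
proof
  assume fixer: "universal_fixer G"
  let ?V = "pverts G" and ?E = "parcs G"
  define N S where "N = ?E `` {p}" and "S = insert p N"
  have NV: "N \<subseteq> ?V" and SV: "S \<subseteq> ?V" and pV: "p \<in> ?V"
    using in_arcsD1 in_arcsD2 assms by (auto simp: N_def S_def)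
  have pN: "p \<notin> N"
    using no_loops' by (auto simp: N_def)
  have "finite N"
    using NV by (auto intro: finite_subset[OF _ pair_finite_verts])
  have d: "0 < int (card N)"
    using assms \<open>finite N\<close> by (auto simp: N_def card_gt_0_iff)
  have sym: "(v, u) \<in> ?E" if "(u, v) \<in> ?E" for u v
    using that arcs_symmetric by blast
  obtain \<phi> :: "'a \<Rightarrow> int" where \<phi>: "bij_betw \<phi> N {1..int (card N)}" and \<phi>0: "\<forall>v. v \<notin> N \<longrightarrow> \<phi> v = 0"
    and extremal: "\<forall>y\<in>N. \<forall>z\<in>N. \<phi> y = \<phi> z + 1 \<longrightarrow>
      (\<Sum>v\<in>?E `` {z} - {y}. \<phi> v) \<le> (\<Sum>v\<in>?E `` {y} - {z}. \<phi> v)"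
    by (rule extremal_numbering[OF NV])
  have pos: "0 < \<phi> v" if "v \<in> N" for v
    using bij_betw_apply[OF \<phi> that] by simp
  have nonneg: "0 \<le> \<phi> v" for v
    using pos[of v] \<phi>0 by (cases "v \<in> N") auto
  have "bij_betw \<phi> ({p} \<union> N) ({0} \<union> {1..int (card N)})"
    using \<phi> \<phi>0 pN by (intro bij_betw_combine) auto
  moreover have "{0} \<union> {1..int (card N)} = {0..int (card N)}"
    by auto
  ultimately have "bij_betw \<phi> S {0..int (card N)}"
    by (simp add: S_def)
  then obtain \<pi> where \<pi>S: "\<pi> permutes S" and moved: "\<forall>v\<in>S. \<pi> v \<noteq> v"
    and descent: "\<forall>v\<in>S. 0 < \<phi> v \<longrightarrow> \<phi> (\<pi> v) = \<phi> v - 1"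
    using d by (rule cyclic_descent_permutation)
  have "\<pi> permutes ?V"
    using \<pi>S SV by (rule permutes_subset)
  moreover from this have "domination_number (permutation_graph \<pi> G) = domination_number G"
    using fixer by (simp add: universal_fixer_def)
  ultimately obtain X Y where XY: "complementary_pair G X Y"
    and \<pi>YX: "complementary_pair G (\<pi> ` Y) (\<pi> ` X)"
    by (rule fixed_domination_number_splits)
  have inj: "\<pi> u = \<pi> v \<longleftrightarrow> u = v" for u v
    using permutes_inj[OF \<pi>S] by (auto dest: injD)
  have \<pi>_in: "\<pi> v \<in> S \<longleftrightarrow> v \<in> S" for v
    using \<pi>S by (rule permutes_in_image)
  have \<pi>_out: "\<pi> v = v" if "v \<notin> S" for v
    using \<pi>S that by (rule permutes_not_in)
  have Y: "v \<in> Y \<longleftrightarrow> v \<in> ?V \<and> v \<notin> closed_nbhd G X" for v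
    using XY by (auto simp: complementary_pair_def)
  have \<pi>X: "v \<in> \<pi> ` X \<longleftrightarrow> v \<in> ?V \<and> v \<notin> closed_nbhd G (\<pi> ` Y)" for v
    using \<pi>YX unfolding complementary_pair_def by blast
  have XV: "X \<subseteq> ?V" and YV: "Y \<subseteq> ?V"
    using XY by (auto simp: complementary_pair_def)
  have XnY: "x \<noteq> y \<and> (x, y) \<notin> ?E \<and> (y, x) \<notin> ?E" if "x \<in> X" "y \<in> Y" for x y
    using that Y[of y] sym[of y x] by (auto simp: closed_nbhd_def)
  have \<pi>XnY: "\<pi> x \<noteq> \<pi> y \<and> (\<pi> x, \<pi> y) \<notin> ?E \<and> (\<pi> y, \<pi> x) \<notin> ?E" if "x \<in> X" "y \<in> Y" for x y
  proof -
    have "\<pi> x \<notin> closed_nbhd G (\<pi> ` Y)"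
      using \<pi>X that(1) by blast
    then have "\<pi> x \<noteq> \<pi> y" "(\<pi> y, \<pi> x) \<notin> ?E"
      using that(2) unfolding closed_nbhd_def by blast+
    then show ?thesis
      using sym[of "\<pi> x" "\<pi> y"] by blast
  qed
  have S: "S = closed_nbhd G {p}"
    by (auto simp: S_def N_def closed_nbhd_def)
  have Y1: "y = z" if "y \<in> Y" "z \<in> Y" "y \<in> S" "z \<in> S" for y z
    using complementary_pair_packing[OF XY pV] that by (auto simp: S)
  have X1: "x = z" if "x \<in> X" "z \<in> X" "x \<in> S" "z \<in> S" for x z
    using complementary_pair_packing[OF \<pi>YX pV, of "\<pi> x" "\<pi> z"] that \<pi>_in inj by (auto simp: S)
  show False
  proof (cases "X \<inter> S = {}")
    case True
    \<comment> \<open>Here \<open>p\<close> is undominated by \<open>X\<close>, so it is the one element of \<open>Y\<close> in \<open>S\<close>. Then \<open>X\<close> must dominate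
      \<open>\<pi> p\<close>, although \<open>\<pi> p\<close> lies in \<open>\<pi> ` Y\<close>, which has no neighbour in \<open>\<pi> ` X = X\<close>.\<close>
    have pS: "p \<in> S" by (simp add: S_def)
    have fix_X: "\<pi> v = v" if "v \<in> X" for v
      using that True by (intro \<pi>_out) auto
    have pY: "p \<in> Y"
      using True pV Y[of p] sym[of _ p] by (auto simp: closed_nbhd_def S_def N_def)
    have \<pi>p: "\<pi> p \<in> S" "\<pi> p \<noteq> p"
      using pS \<pi>_in moved by auto
    then have "\<pi> p \<notin> Y"
      using Y1[of "\<pi> p" p] pS pY by blast
    then have "\<pi> p \<in> closed_nbhd G X"
      using Y[of "\<pi> p"] SV \<pi>p(1) by blast
    then obtain x where x: "x \<in> X" "x = \<pi> p \<or> (x, \<pi> p) \<in> ?E"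
      by (auto simp: closed_nbhd_def)
    then show False
      using \<pi>XnY[OF x(1) pY] fix_X[OF x(1)] by simp
  next
    case False
    then obtain x where x: "x \<in> X" "x \<in> S" by blast
    have Xout: "v \<notin> S" if "v \<in> X" "v \<noteq> x" for v
      using that X1 x by blast
    have \<pi>Xout: "v \<in> X" if "v \<in> \<pi> ` X" "v \<noteq> \<pi> x" for v
      using that Xout \<pi>_out by force
    have x_out: "x \<notin> \<pi> ` X"
      using \<pi>Xout moved x Xout \<pi>_out inj by (metis imageE)
    \<comment> \<open>As \<open>x\<close> has left \<open>\<pi> ` X\<close>, it must be dominated by \<open>\<pi> ` Y\<close>. Elements of \<open>Y\<close> outside \<open>S\<close> are fixed
      and cannot do this, being in \<open>Y\<close>; hence \<open>Y\<close> meets \<open>S\<close>.\<close>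
    then have "x \<in> closed_nbhd G (\<pi> ` Y)"
      using \<pi>X XV x by blast
    then obtain y where yY: "y \<in> Y" and y_dom: "x = \<pi> y \<or> (\<pi> y, x) \<in> ?E"
      by (auto simp: closed_nbhd_def)
    have "y \<in> S"
    proof (rule ccontr)
      assume "y \<notin> S"
      then show False
        using y_dom XnY[OF x(1) yY] \<pi>_out[of y] by simp
    qed
    note y = yY this
    have Yout: "\<pi> v = v" if "v \<in> Y" "v \<noteq> y" for v
      using that Y1 y \<pi>_out by blast
    have nxy: "x \<noteq> y" "(x, y) \<notin> ?E" "(y, x) \<notin> ?E"
      using XnY[OF x(1) y(1)] by auto
    have nxy': "\<pi> x \<noteq> \<pi> y" "(\<pi> x, \<pi> y) \<notin> ?E" "(\<pi> y, \<pi> x) \<notin> ?E"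
      using \<pi>XnY[OF x(1) y(1)] by auto
    \<comment> \<open>Two distinct nonadjacent vertices of \<open>S\<close> both differ from \<open>p\<close>.\<close>
    have xyN: "x \<in> N" "y \<in> N"
      using nxy x(2) y(2) sym[of p x] sym[of p y] by (auto simp: S_def N_def)
    have "\<pi> x \<in> S" "\<pi> y \<in> S"
      using x y \<pi>_in by auto
    then have xyN': "\<pi> x \<in> N" "\<pi> y \<in> N"
      using nxy' sym[of p "\<pi> x"] sym[of p "\<pi> y"] by (auto simp: S_def N_def)
    have \<phi>x: "\<phi> x = \<phi> (\<pi> x) + 1" and \<phi>y: "\<phi> y = \<phi> (\<pi> y) + 1"
      using descent x(2) y(2) pos[OF xyN(1)] pos[OF xyN(2)] by auto
    \<comment> \<open>The neighbourhood of \<open>\<pi> y\<close> contains that of \<open>y\<close>, up to \<open>\<pi> x\<close>: a vertex near \<open>y\<close> is outside \<open>X\<close>,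
      hence outside \<open>\<pi> ` X\<close> unless it is \<open>\<pi> x\<close>, hence dominated by \<open>\<pi> ` Y\<close>; and by the packing property
      no element of \<open>Y\<close> other than \<open>y\<close> is near it.\<close>
    have sub: "w = \<pi> x \<or> w = \<pi> y \<or> (\<pi> y, w) \<in> ?E" if w: "w = y \<or> (y, w) \<in> ?E" for w
    proof (rule ccontr)
      assume *: "\<not> ?thesis"
      have wV: "w \<in> ?V" using w y(1) YV in_arcsD2[of y w] by auto
      have "w \<notin> X" using w XnY[OF _ y(1)] by blast
      then have "w \<notin> \<pi> ` X" using \<pi>Xout * by blast
      then have "w \<in> closed_nbhd G (\<pi> ` Y)" using \<pi>X wV by blast
      then obtain z where z: "z \<in> Y" "w = \<pi> z \<or> (\<pi> z, w) \<in> ?E"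
        by (auto simp: closed_nbhd_def)
      then have "z \<noteq> y" using * by blast
      then have "w = z \<or> (z, w) \<in> ?E" using z Yout by simp
      then have "y = z"
        using complementary_pair_packing[OF XY wV, of y z] w y(1) z(1) sym[of y w] sym[of z w]
        by (auto simp: closed_nbhd_def)
      then show False using \<open>z \<noteq> y\<close> by simp
    qed
    \<comment> \<open>If \<open>x = \<pi> y\<close>, then \<open>y\<close> could only be \<open>\<pi> x\<close>, but \<open>\<phi>\<close> cannot decrease all the way round a
      2-cycle.\<close>
    have ne: "x \<noteq> \<pi> y"
    proof
      assume *: "x = \<pi> y"
      have "y \<noteq> \<pi> x"
      proof
        assume "y = \<pi> x"
        then have "\<phi> y = \<phi> (\<pi> x)" by (rule arg_cong)
        moreover have "\<phi> x = \<phi> (\<pi> y)" using * by (rule arg_cong)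
        ultimately show False using \<phi>x \<phi>y by linarith
      qed
      moreover have "y \<noteq> \<pi> y" "(\<pi> y, y) \<notin> ?E"
        unfolding *[symmetric] using nxy by auto
      ultimately show False
        using sub[of y] by blast
    qed
    then have xE: "(\<pi> y, x) \<in> ?E" using y_dom by blast
    have fin: "finite (?E `` {v})" for v
      by (rule finite_subset[of _ ?V]) (use in_arcsD2 in auto)
    \<comment> \<open>Exchanging the possible neighbour \<open>\<pi> x\<close> of \<open>y\<close> for \<open>x\<close> gains one, since \<open>\<phi> x = \<phi> (\<pi> x) + 1\<close>.\<close>
    have "(\<Sum>v\<in>?E `` {y} - {\<pi> y}. \<phi> v) \<le> (\<Sum>v\<in>insert (\<pi> x) (?E `` {y} - {\<pi> y, \<pi> x}). \<phi> v)"
      using fin nonneg by (intro sum_mono2) auto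
    also have "\<dots> = \<phi> (\<pi> x) + (\<Sum>v\<in>?E `` {y} - {\<pi> y, \<pi> x}. \<phi> v)"
      using fin by (subst sum.insert) auto
    also have "\<dots> < \<phi> x + (\<Sum>v\<in>?E `` {y} - {\<pi> y, \<pi> x}. \<phi> v)"
      using \<phi>x by simp
    also have "\<dots> = (\<Sum>v\<in>insert x (?E `` {y} - {\<pi> y, \<pi> x}). \<phi> v)"
      using fin nxy by (subst sum.insert) auto
    also have "\<dots> \<le> (\<Sum>v\<in>?E `` {\<pi> y} - {y}. \<phi> v)"
    proof (rule sum_mono2)
      show "insert x (?E `` {y} - {\<pi> y, \<pi> x}) \<subseteq> ?E `` {\<pi> y} - {y}"
        using sub xE nxy no_loops' by blast
    qed (use fin nonneg in auto)
    finally show False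
      using extremal xyN(2) xyN'(2) \<phi>y by force
  qed
qed

section \<open>Edgeless graphs\<close>

lemma universal_fixer_if_no_arcs:
  assumes fin: "finite (pverts G)" and "parcs G = {}"
  shows "universal_fixer G"
  unfolding universal_fixer_def
proof (intro allI impI)
  fix \<pi> assume \<pi>: "\<pi> permutes pverts G"
  let ?V = "pverts G" and ?H = "permutation_graph \<pi> G"
  have finH: "finite (pverts ?H)"
    using fin by (simp add: permutation_graph_def)
  have "domination_number G = card ?V"
  proof -
    obtain D where "dominating_set G D" "card D = domination_number G"
      using domination_number_attained fin by blast
    moreover from this have "D = ?V"
      using assms by (auto simp: dominating_set_def)
    ultimately show ?thesis by simp
  qed
  moreover have "domination_number ?H \<le> card ?V"
  proof -
    have "dominating_set ?H (Inl ` ?V)"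
      using permutes_image[OF \<pi>] by (force simp: dominating_set_def permutation_graph_def)
    then have "domination_number ?H \<le> card (Inl ` ?V :: ('a + 'a) set)"
      by (rule domination_number_le[OF finH])
    then show ?thesis by (simp add: card_image)
  qed
  moreover have "card ?V \<le> domination_number ?H"
  proof -
    obtain D where D: "dominating_set ?H D" "card D = domination_number ?H"
      using domination_number_attained finH by blast
    \<comment> \<open>The only edge at \<open>Inl u\<close> is the one to \<open>Inr (\<pi> u)\<close>; projecting each such edge to \<open>u\<close> maps \<open>D\<close>
      onto the vertex set.\<close>
    have "u \<in> case_sum id (inv \<pi>) ` D" if "u \<in> ?V" for u
    proof -
      have "Inl u \<in> D \<or> Inr (\<pi> u) \<in> D"
        using D(1) that assms permutes_inj[OF \<pi>]
        by (auto simp: dominating_set_def permutation_graph_def dest: injD)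
      then show ?thesis
        using image_eqI[of u "case_sum id (inv \<pi>)" "Inl u" D]
          image_eqI[of u "case_sum id (inv \<pi>)" "Inr (\<pi> u)" D] permutes_inverses(2)[OF \<pi>]
        by auto
    qed
    then have "card ?V \<le> card (case_sum id (inv \<pi>) ` D)"
      using D finH by (intro card_mono) (auto simp: dominating_set_def dest: finite_subset)
    also have "\<dots> \<le> card D"
      using D finH by (intro card_image_le) (auto simp: dominating_set_def dest: finite_subset)
    finally show ?thesis using D by simp
  qed
  ultimately show "domination_number ?H = domination_number G"
    by simp
qed

lemma (in pair_graph) iso_edgeless_graph_iff:
  "digraph_iso (with_proj G) (with_proj (edgeless_graph (card (pverts G)))) \<longleftrightarrow> parcs G = {}"
proof
  assume "digraph_iso (with_proj G) (with_proj (edgeless_graph (card (pverts G))))"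
  then obtain f where "with_proj (edgeless_graph (card (pverts G))) = app_iso f (with_proj G)"
    unfolding digraph_iso_def by blast
  from arg_cong[OF this, of arcs] show "parcs G = {}"
    by (simp add: edgeless_graph_def)
next
  assume E: "parcs G = {}"
  obtain h where h: "bij_betw h (pverts G) {..<card (pverts G)}"
    using finite_same_card_bij[of "pverts G" "{..<card (pverts G)}"] by auto
  let ?f = "\<lparr> iso_verts = h, iso_arcs = \<lambda>a. undefined, iso_head = snd, iso_tail = fst \<rparr>"
  have "pre_digraph.digraph_isomorphism (with_proj G) ?f"
    using h E wf_digraph_wp_iff pair_wf_digraph
    by (auto simp: pre_digraph.digraph_isomorphism_def bij_betw_def)
  moreover have "with_proj (edgeless_graph (card (pverts G))) = app_iso ?f (with_proj G)"
    using h E by (simp add: with_proj_def app_iso_def edgeless_graph_def bij_betw_def)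
  ultimately show "digraph_iso (with_proj G) (with_proj (edgeless_graph (card (pverts G))))"
    unfolding digraph_iso_def by blast
qed

theorem theorem1p1:
  fixes G :: "'a pair_pre_digraph" and n :: nat
  assumes "pair_graph G"
    and "card (pverts G) = n"
  shows "universal_fixer G \<longleftrightarrow> digraph_iso (with_proj G) (with_proj (edgeless_graph n))"
proof -
  interpret pair_graph G by fact
  have "universal_fixer G \<longleftrightarrow> parcs G = {}"
    using universal_fixer_if_no_arcs[OF pair_finite_verts] not_universal_fixer_if_arc by auto
  then show ?thesis
    using iso_edgeless_graph_iff assms(2) by simp
qed

end
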